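(* Let $A\in\mathbf{C}^{n\times n}$ have distinct singular values $\sigma_1(A),\ldots,\sigma_n(A)$, and let $A=U^{H}\Sigma V$ be a singular value decomposition of $A$, where $U=(u_{ij})_{1\le i,j\le n}$ and $V=(v_{ls})_{1\le l,s\le n}$ are $n\times n$ unitary matrices and $\Sigma=\operatorname{diag}(\sigma_1(A),\ldots,\sigma_n(A))$. For $1\le j\le n$ let $\bar{A}_j$ be the $(n-1)\times n$ matrix obtained by deleting the $j$-th row of $A$, with singular values $\sigma_k(\bar{A}_j)$, $1\le k\le n-1$. For $1\le s\le n$ let $\hat{A}_s$ be the $n\times(n-1)$ matrix obtained by deleting the $s$-th column of $A$, with singular values $\sigma_t(\hat{A}_s)$, $1\le t\le n-1$. Then \[ |u_{ij}|^{2}=\frac{\prod_{k=1}^{n-1}\left(\sigma_{i}^{2}(A)-\sigma_{k}^{2}(\bar{A}_{j})\right)}{\prod_{k=1,\,k\neq i}^{n}\left(\sigma_{i}^{2}(A)-\sigma_{k}^{2}(A)\right)},\qquad 1\leq i,j\leq n, \] and \[ |v_{ls}|^{2}=\frac{\prod_{t=1}^{n-1}\left(\sigma_{l}^{2}(A)-\sigma_{t}^{2}(\hat{A}_{s})\right)}{\prod_{t=1,\,t\neq l}^{n}\left(\sigma_{l}^{2}(A)-\sigma_{t}^{2}(A)\right)},\qquad 1\leq l,s\leq n. \]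
   Context: $M^{H}$ denotes the conjugate transpose of a complex matrix $M$. The singular value decomposition is written in the form $A=U^{H}\Sigma V$ (not $U\Sigma V^{H}$), so $AA^{H}=U^{H}\Sigma\Sigma^{H}U$ and $A^{H}A=V^{H}\Sigma^{H}\Sigma V$; $u_{ij}$ and $v_{ls}$ are the $(i,j)$ entry of $U$ and the $(l,s)$ entry of $V$. Singular values are nonnegative reals, listed with multiplicity: a $p\times q$ matrix with $p\le q$ (resp. $q\le p$) has $p$ (resp. $q$) singular values, the square roots of the eigenvalues of $MM^{H}$ (resp. $M^{H}M$). Empty products equal $1$. *)

theory Defs
  imports
    "Jordan_Normal_Form.Schur_Decomposition"
    "Jordan_Normal_Form.DL_Submatrix"
    "HOL-Computational_Algebra.Fundamental_Theorem_Algebra"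
begin

definition unitary_mat :: "nat \<Rightarrow> complex mat \<Rightarrow> bool" where
  "unitary_mat n U \<longleftrightarrow> U \<in> carrier_mat n n
     \<and> U * mat_adjoint U = 1\<^sub>m n \<and> mat_adjoint U * U = 1\<^sub>m n"

(* The Gram matrix is positive semidefinite, so its eigenvalues are nonnegative reals and
   Re loses nothing.  Taking the smaller of the two Gram matrices gives exactly
   min (dim_row M) (dim_col M) singular values; see size_singular_values below. *)
definition singular_values :: "complex mat \<Rightarrow> real multiset" where
  "singular_values M = image_mset (\<lambda>z. sqrt (Re z))
     (proots (char_poly (if dim_row M \<le> dim_col M
                         then M * mat_adjoint M else mat_adjoint M * M)))"

lemma size_singular_values: "size (singular_values M) = min (dim_row M) (dim_col M)"
proof -
  define G where "G = (if dim_row M \<le> dim_col M then M * mat_adjoint M else mat_adjoint M * M)"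
  have G: "G \<in> carrier_mat (min (dim_row M) (dim_col M)) (min (dim_row M) (dim_col M))"
    by (auto simp: G_def mat_adjoint_def)
  obtain B where B: "size B = degree (char_poly G)"
    "char_poly G = smult (lead_coeff (char_poly G)) (\<Prod>x\<in>#B. [:- x, 1:])"
    using alg_closed_imp_factorization degree_monic_char_poly[OF G] by (metis leading_coeff_0_iff zero_neq_one)
  have "proots (\<Prod>x\<in>#C. [:- x, 1:]) = C" for C :: "complex multiset"
  proof (induction C)
    case (add x C)
    have "(\<Prod>x\<in>#C. [:- x, 1:]) \<noteq> 0"
      by (auto simp: prod_mset_zero_iff)
    then have "proots ([:- x, 1:] * (\<Prod>x\<in>#C. [:- x, 1:])) = proots [:- x, 1:] + C"
      using add by (subst proots_mult) auto
    then show ?case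
      by simp
  qed simp
  then have "proots (char_poly G) = B"
    by (subst B(2)) (use degree_monic_char_poly[OF G] in simp)
  then show ?thesis
    using B(1) degree_monic_char_poly[OF G] by (simp add: singular_values_def G_def)
qed

(* sigma 0, ..., sigma (m - 1) lists the singular values of M with multiplicity,
   m = min (dim_row M) (dim_col M), in no particular order *)
definition lists_singular_values :: "(nat \<Rightarrow> real) \<Rightarrow> complex mat \<Rightarrow> bool" where
  "lists_singular_values \<sigma> M \<longleftrightarrow>
     image_mset \<sigma> (mset_set {..<min (dim_row M) (dim_col M)}) = singular_values M"

definition delete_row :: "nat \<Rightarrow> 'a mat \<Rightarrow> 'a mat" where
  "delete_row j A = submatrix A (- {j}) UNIV"

definition delete_col :: "nat \<Rightarrow> 'a mat \<Rightarrow> 'a mat" where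
  "delete_col s A = submatrix A UNIV (- {s})"

lemma dim_delete_row:
  assumes "j < dim_row A"
  shows "dim_row (delete_row j A) = dim_row A - 1" "dim_col (delete_row j A) = dim_col A"
proof -
  have "{i. i < dim_row A \<and> i \<in> - {j}} = {..<dim_row A} - {j}"
    by auto
  then show "dim_row (delete_row j A) = dim_row A - 1" "dim_col (delete_row j A) = dim_col A"
    using assms by (simp_all add: delete_row_def dim_submatrix)
qed

lemma dim_delete_col:
  assumes "s < dim_col A"
  shows "dim_row (delete_col s A) = dim_row A" "dim_col (delete_col s A) = dim_col A - 1"
proof -
  have "{i. i < dim_col A \<and> i \<in> - {s}} = {..<dim_col A} - {s}"
    by auto
  then show "dim_row (delete_col s A) = dim_row A" "dim_col (delete_col s A) = dim_col A - 1"
    using assms by (simp_all add: delete_col_def dim_submatrix)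
qed

end

theory Submission
  imports Defs
begin

text \<open>
  Write \<open>H = A A\<^sup>H = U\<^sup>H \<Sigma>\<^sup>2 U\<close>. Deleting row \<open>j\<close> of \<open>A\<close> deletes row and column \<open>j\<close>
  of \<open>H\<close>, so the squared singular values of the truncated matrix are the roots of the
  characteristic polynomial of a principal minor of \<open>H\<close>. That polynomial is the \<open>(j, j)\<close> entry of
  the adjugate of \<open>x - H = U\<^sup>H (x - \<Sigma>\<^sup>2) U\<close>. The adjugate is diagonalised by \<open>U\<close> as well, with
  \<open>k\<close>-th eigenvalue \<open>\<Prod>l\<noteq>k. (x - \<sigma>\<^sub>l\<^sup>2)\<close>, and comparing \<open>(j, j)\<close> entries gives
  \<open>\<Prod>k. (x - \<tau>\<^sub>k\<^sup>2) = \<Sum>k. |u\<^sub>k\<^sub>j|\<^sup>2 * \<Prod>l\<noteq>k. (x - \<sigma>\<^sub>l\<^sup>2)\<close>,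
  where the \<open>\<tau>\<^sub>k\<close> are the singular values of the truncated matrix. At \<open>x = \<sigma>\<^sub>i\<^sup>2\<close> only the term
  \<open>k = i\<close> survives; this is \<open>singular_vector_entry_rows\<close>. Since singular values are nonnegative,
  distinct ones have distinct squares, and one may divide by the remaining product.

  The algebraic core is \<open>det_mat_delete_diagonalised\<close>, an adjugate computation over an arbitrary
  integral domain; working over the polynomial ring makes the diagonal entries \<open>x - \<sigma>\<^sub>l\<^sup>2\<close>
  nonzero, hence cancellable, which they are not after a value is put in for \<open>x\<close>.
  The passage between multisets of singular values and polynomials is \<open>char_poly_gram_eq_prod\<close>.

  The formula for \<open>V\<close> is the formula for \<open>U\<close> applied to \<open>A\<^sup>H = V\<^sup>H \<Sigma> U\<close>, whose rows are the
  conjugated columns of \<open>A\<close>.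
\<close>

section \<open>Conjugate transposes\<close>

lemma mat_adjoint_carrier: "A \<in> carrier_mat m n \<Longrightarrow> mat_adjoint A \<in> carrier_mat n m"
  by (auto simp: mat_adjoint_def)

lemma dim_mat_adjoint [simp]:
  "dim_row (mat_adjoint A) = dim_col A" "dim_col (mat_adjoint A) = dim_row A"
  by (auto simp: mat_adjoint_def)

lemma mat_adjoint_index:
  assumes "i < dim_col A" "j < dim_row A"
  shows "mat_adjoint A $$ (i, j) = conjugate (A $$ (j, i))"
  using assms by (simp add: mat_adjoint_def mat_of_rows_index)

lemma mat_adjoint_adjoint: "mat_adjoint (mat_adjoint A) = A"
  by (rule eq_matI) (auto simp: mat_adjoint_index)

lemma mat_adjoint_mult:
  fixes A B :: "complex mat"
  assumes "A \<in> carrier_mat m k" "B \<in> carrier_mat k n"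
  shows "mat_adjoint (A * B) = mat_adjoint B * mat_adjoint A"
  using assms
  by (intro eq_matI)
     (auto simp: mat_adjoint_index scalar_prod_def mult.commute intro!: sum.cong)

lemma mat_adjoint_real_diag:
  "mat_adjoint (mat_diag n (\<lambda>i. complex_of_real (d i))) = mat_diag n (\<lambda>i. complex_of_real (d i))"
  by (rule eq_matI) (auto simp: mat_adjoint_index mat_diag_def)

lemma mat_adjoint_svd:
  assumes "U \<in> carrier_mat n n" "V \<in> carrier_mat n n"
  shows "mat_adjoint (mat_adjoint U * mat_diag n (\<lambda>i. complex_of_real (\<sigma> i)) * V) =
    mat_adjoint V * mat_diag n (\<lambda>i. complex_of_real (\<sigma> i)) * U"
proof -
  define S where "S = mat_diag n (\<lambda>i. complex_of_real (\<sigma> i))"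
  have S: "S \<in> carrier_mat n n"
    by (simp add: S_def)
  note U' = mat_adjoint_carrier[OF assms(1)] and V' = mat_adjoint_carrier[OF assms(2)]
  have "mat_adjoint (mat_adjoint U * S * V) = mat_adjoint V * (mat_adjoint S * U)"
    using assms S U'
    by (simp only: mat_adjoint_mult[OF mult_carrier_mat[OF U' S] assms(2)]
        mat_adjoint_mult[OF U' S] mat_adjoint_adjoint)
  also have "mat_adjoint S = S"
    by (simp add: S_def mat_adjoint_real_diag)
  also have "mat_adjoint V * (S * U) = mat_adjoint V * S * U"
    by (rule assoc_mult_mat[OF V' S assms(1), symmetric])
  finally show ?thesis
    by (simp add: S_def)
qed

section \<open>Deleting a row or a column\<close>

text \<open>
  Two encodings of a deletion meet here: \<open>delete_row\<close> selects the indices by \<open>pick\<close>, whereas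
  \<open>mat_delete\<close>, which occurs in cofactors, shifts them past the gap, as \<open>insert_index\<close> does.
\<close>

lemma pick_compl_singleton: "pick (- {j}) i = insert_index j i"
proof -
  have "card {a \<in> - {j}. a < insert_index j i} = i"
  proof (cases "i < j")
    case True
    then have "{a \<in> - {j}. a < insert_index j i} = {..<i}"
      by auto
    then show ?thesis by simp
  next
    case False
    then have "{a \<in> - {j}. a < insert_index j i} = {..<Suc i} - {j}"
      by auto
    then show ?thesis using False by simp
  qed
  moreover have "insert_index j i \<in> - {j}"
    by simp
  ultimately show ?thesis
    using pick_card_in_set by metis
qed

lemma delete_row_index:
  assumes "j < dim_row A" "a < dim_row A - 1" "b < dim_col A"
  shows "delete_row j A $$ (a, b) = A $$ (insert_index j a, b)"
proof -
  have "a < card {i. i < dim_row A \<and> i \<in> - {j}}" "b < card {i. i < dim_col A \<and> i \<in> UNIV}"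
    using assms dim_delete_row[of j A] by (simp_all add: delete_row_def dim_submatrix)
  then show ?thesis
    unfolding delete_row_def by (simp only: submatrix_index pick_compl_singleton pick_UNIV)
qed

lemma delete_col_index:
  assumes "s < dim_col A" "a < dim_row A" "b < dim_col A - 1"
  shows "delete_col s A $$ (a, b) = A $$ (a, insert_index s b)"
proof -
  have "b < card {i. i < dim_col A \<and> i \<in> - {s}}" "a < card {i. i < dim_row A \<and> i \<in> UNIV}"
    using assms dim_delete_col[of s A] by (simp_all add: delete_col_def dim_submatrix)
  then show ?thesis
    unfolding delete_col_def by (simp only: submatrix_index pick_compl_singleton pick_UNIV)
qed

lemma insert_index_less: "j < n \<Longrightarrow> a < n - 1 \<Longrightarrow> insert_index j a < n"
  by (auto simp: insert_index_def)

lemma delete_row_mat_adjoint: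
  fixes A :: "complex mat"
  assumes "s < dim_col A"
  shows "delete_row s (mat_adjoint A) = mat_adjoint (delete_col s A)"
  using assms
  by (intro eq_matI)
     (auto simp: dim_delete_row dim_delete_col delete_row_index delete_col_index
        mat_adjoint_index insert_index_less)

lemma delete_row_gram:
  fixes A :: "complex mat"
  assumes "j < dim_row A"
  shows "delete_row j A * mat_adjoint (delete_row j A) = mat_delete (A * mat_adjoint A) j j"
  using assms
  by (intro eq_matI)
     (auto simp: dim_delete_row delete_row_index mat_adjoint_index mat_delete_index[symmetric]
        mat_delete_def scalar_prod_def insert_index_def)

section \<open>Principal minors of a diagonalised matrix\<close>

lemma det_mat_diag: "det (mat_diag n d) = (\<Prod>i<n. d i)"
proof -
  have "det (mat_diag n d) = prod_list (diag_mat (mat_diag n d))"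
    by (rule det_upper_triangular[of _ n]) (auto simp: mat_diag_def)
  also have "\<dots> = (\<Prod>i<n. d i)"
    by (subst prod_list_diag_prod) (auto simp: mat_diag_def lessThan_atLeast0)
  finally show ?thesis .
qed

text \<open>
  The minor is a diagonal entry of the adjugate of \<open>M = P D Q\<close>. From \<open>adj M \<cdot> M = det M\<close> and
  \<open>M P = P D\<close> one gets \<open>(adj M \<cdot> P) D = det M \<cdot> P\<close>; as \<open>det M\<close> is the product of the \<open>d l\<close>,
  the factor \<open>d k\<close> cancels in column \<open>k\<close>. This yields \<open>adj M \<cdot> P\<close>, and then \<open>adj M\<close> after
  multiplication by \<open>Q\<close>. The cancellation is what the nonzero \<open>d k\<close> are for.
\<close>

lemma det_mat_delete_diagonalised:
  fixes P Q :: "'a :: idom mat"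
  assumes P: "P \<in> carrier_mat n n" and Q: "Q \<in> carrier_mat n n"
    and PQ: "P * Q = 1\<^sub>m n" and QP: "Q * P = 1\<^sub>m n"
    and d: "\<And>k. k < n \<Longrightarrow> d k \<noteq> 0"
    and j: "j < n"
  shows "det (mat_delete (P * mat_diag n d * Q) j j) =
    (\<Sum>k<n. P $$ (j, k) * Q $$ (k, j) * (\<Prod>l\<in>{..<n} - {k}. d l))"
proof -
  define D where "D = mat_diag n d"
  define M where "M = P * D * Q"
  define N where "N = adj_mat M * P"
  have D: "D \<in> carrier_mat n n"
    by (simp add: D_def)
  have M: "M \<in> carrier_mat n n"
    using P D Q by (simp add: M_def)
  have adjM: "adj_mat M \<in> carrier_mat n n"
    by (rule adj_mat(1)[OF M])
  have N: "N \<in> carrier_mat n n"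
    using adjM P by (simp add: N_def)
  have "det P * det Q = 1"
    using det_mult[OF P Q] PQ by simp
  then have det_M: "det M = (\<Prod>l<n. d l)"
    using det_mult[OF mult_carrier_mat[OF P D] Q] det_mult[OF P D]
    by (simp add: M_def D_def det_mat_diag algebra_simps)
  have "M * P = P * D"
    using P D Q QP by (simp add: M_def assoc_mult_mat[of _ n n _ n _ n])
  then have "N * D = adj_mat M * (M * P)"
    using adjM P D by (simp add: N_def assoc_mult_mat[of _ n n _ n _ n])
  also have "\<dots> = (det M \<cdot>\<^sub>m 1\<^sub>m n) * P"
    using adjM M P adj_mat(3)[OF M] by (simp flip: assoc_mult_mat[of _ n n _ n _ n])
  also have "\<dots> = det M \<cdot>\<^sub>m P"
    using P by (subst mult_smult_assoc_mat[of _ n n _ n]) auto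
  finally have ND: "N * D = det M \<cdot>\<^sub>m P" .
  have entry: "N $$ (j, k) = P $$ (j, k) * (\<Prod>l\<in>{..<n} - {k}. d l)" if k: "k < n" for k
  proof -
    have "N $$ (j, k) * d k = (N * D) $$ (j, k)"
      using N j k by (simp add: D_def mat_diag_mult_right[OF N])
    also have "\<dots> = P $$ (j, k) * (\<Prod>l\<in>{..<n} - {k}. d l) * d k"
      using P j k by (simp add: ND det_M prod.remove[of "{..<n}" k])
    finally show ?thesis
      using d[OF k] by simp
  qed
  have "adj_mat M = N * Q"
    using adjM P Q PQ by (simp add: N_def assoc_mult_mat[of _ n n _ n _ n])
  then have "adj_mat M $$ (j, j) = (\<Sum>k<n. N $$ (j, k) * Q $$ (k, j))"
    using N Q j by (simp add: scalar_prod_def lessThan_atLeast0)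
  also have "\<dots> = (\<Sum>k<n. P $$ (j, k) * Q $$ (k, j) * (\<Prod>l\<in>{..<n} - {k}. d l))"
    by (intro sum.cong) (auto simp: entry)
  moreover have "adj_mat M $$ (j, j) = det (mat_delete M j j)"
    using M j by (simp add: adj_mat_def cofactor_def)
  ultimately show ?thesis
    by (simp add: M_def D_def)
qed

lemma char_poly_matrix_mat_delete:
  assumes "A \<in> carrier_mat n n" "j < n"
  shows "mat_delete (char_poly_matrix A) j j = char_poly_matrix (mat_delete A j j)"
  using assms by (intro eq_matI) (auto simp: mat_delete_def char_poly_matrix_def)

text \<open>
  This is the previous lemma over the polynomial ring, for \<open>x - P D Q = P (x - D) Q\<close>. The
  diagonal entries \<open>x - d l\<close> are nonzero polynomials whatever \<open>d\<close> is.
\<close>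

lemma char_poly_mat_delete_diagonalised:
  fixes P Q :: "'a :: idom mat"
  assumes P: "P \<in> carrier_mat n n" and Q: "Q \<in> carrier_mat n n"
    and PQ: "P * Q = 1\<^sub>m n" and QP: "Q * P = 1\<^sub>m n"
    and j: "j < n"
  shows "char_poly (mat_delete (P * mat_diag n d * Q) j j) =
    (\<Sum>k<n. smult (P $$ (j, k) * Q $$ (k, j)) (\<Prod>l\<in>{..<n} - {k}. [:- d l, 1:]))"
proof -
  interpret const_poly: comm_ring_hom "\<lambda>c :: 'a. [:c:]"
    by standard (auto simp: one_pCons)
  let ?c = "map_mat (\<lambda>c. [:c:])"
  define D where "D = mat_diag n d"
  define X where "X = mat_diag n (\<lambda>l. [:- d l, 1:])"
  have D: "D \<in> carrier_mat n n" and X: "X \<in> carrier_mat n n"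
    by (simp_all add: D_def X_def)
  have PQ': "?c P * ?c Q = 1\<^sub>m n" and QP': "?c Q * ?c P = 1\<^sub>m n"
    using const_poly.mat_hom_mult[OF P Q] const_poly.mat_hom_mult[OF Q P]
    by (simp_all add: PQ QP const_poly.mat_hom_one)
  have X_eq: "X = [:0, 1:] \<cdot>\<^sub>m 1\<^sub>m n - ?c D"
    by (rule eq_matI) (auto simp: X_def D_def mat_diag_def)
  have "?c P * X * ?c Q = ?c P * ([:0, 1:] \<cdot>\<^sub>m 1\<^sub>m n) * ?c Q - ?c P * ?c D * ?c Q"
    unfolding X_eq using P Q D
    by (subst mult_minus_distrib_mat[of _ n n _ n]) (auto simp: minus_mult_distrib_mat[of _ n n _ _ n])
  also have "?c P * ([:0, 1:] \<cdot>\<^sub>m 1\<^sub>m n) * ?c Q = [:0, 1:] \<cdot>\<^sub>m 1\<^sub>m n"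
    using P Q PQ' by (simp add: mult_smult_distrib[of _ n n _ n] mult_smult_assoc_mat[of _ n n _ n])
  also have "?c P * ?c D * ?c Q = ?c (P * D * Q)"
    using P Q D by (simp add: const_poly.mat_hom_mult[of _ n n _ n])
  also have "[:0, 1:] \<cdot>\<^sub>m 1\<^sub>m n - ?c (P * D * Q) = char_poly_matrix (P * D * Q)"
    using P Q D by (intro eq_matI) (auto simp: char_poly_matrix_def)
  finally have "char_poly_matrix (P * D * Q) = ?c P * X * ?c Q" ..
  moreover have "P * D * Q \<in> carrier_mat n n"
    using P Q D by simp
  ultimately have "char_poly (mat_delete (P * D * Q) j j) = det (mat_delete (?c P * X * ?c Q) j j)"
    using char_poly_matrix_mat_delete[of "P * D * Q" n j] j by (simp add: char_poly_def)
  also have "\<dots> = (\<Sum>k<n. ?c P $$ (j, k) * ?c Q $$ (k, j) * (\<Prod>l\<in>{..<n} - {k}. [:- d l, 1:]))"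
    unfolding X_def
    by (rule det_mat_delete_diagonalised) (use P Q PQ' QP' j in auto)
  also have "\<dots> = (\<Sum>k<n. smult (P $$ (j, k) * Q $$ (k, j)) (\<Prod>l\<in>{..<n} - {k}. [:- d l, 1:]))"
    using P Q j by (intro sum.cong) (auto simp: mult.commute)
  finally show ?thesis
    by (simp add: D_def)
qed

section \<open>Singular values and the characteristic polynomial of the Gram matrix\<close>

text \<open>
  If \<open>v\<close> is an eigenvector of \<open>M M\<^sup>H\<close> for \<open>z\<close> and \<open>w = M\<^sup>H v\<close>, then \<open>z |v|\<^sup>2 = v\<^sup>H M M\<^sup>H v = |w|\<^sup>2\<close>.
  Hence taking \<open>Re\<close> and the square root in \<open>singular_values\<close> can be undone by squaring.
\<close>

lemma proots_gram_nonneg: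
  fixes M :: "complex mat"
  assumes "z \<in># proots (char_poly (M * mat_adjoint M))"
  shows "z = complex_of_real (Re z)" "Re z \<ge> 0"
proof -
  define m where "m = dim_row M"
  define n where "n = dim_col M"
  define G where "G = M * mat_adjoint M"
  have M: "M \<in> carrier_mat m n"
    unfolding m_def n_def by blast
  have G: "G \<in> carrier_mat m m"
    unfolding G_def using M mat_adjoint_carrier[OF M] by (rule mult_carrier_mat)
  have "char_poly G \<noteq> 0"
    using degree_monic_char_poly[OF G] by auto
  then have "poly (char_poly G) z = 0"
    using assms by (simp add: G_def)
  then obtain v where v: "v \<in> carrier_vec m" "v \<noteq> 0\<^sub>v m" "G *\<^sub>v v = z \<cdot>\<^sub>v v"
    using eigenvalue_root_char_poly[OF G] G unfolding eigenvalue_def eigenvector_def by auto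
  define w where "w = mat_adjoint M *\<^sub>v v"
  define r where "r = (\<Sum>i<m. (cmod (v $ i))\<^sup>2)"
  define s where "s = (\<Sum>k<n. (cmod (w $ k))\<^sup>2)"
  have w: "w \<in> carrier_vec n"
    unfolding w_def using mat_adjoint_carrier[OF M] v(1) by (rule mult_mat_vec_carrier)
  have Mw: "M *\<^sub>v w = z \<cdot>\<^sub>v v"
    using v(3) assoc_mult_mat_vec[OF M mat_adjoint_carrier[OF M] v(1)]
    by (simp add: G_def w_def)
  have w_eq: "w $ k = (\<Sum>i<m. cnj (M $$ (i, k)) * v $ i)" if "k < n" for k
    using M v that by (simp add: w_def scalar_prod_def lessThan_atLeast0 mat_adjoint_index)
  have Mw_eq: "z * v $ i = (\<Sum>k<n. M $$ (i, k) * w $ k)" if "i < m" for i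
  proof -
    have "z * v $ i = (M *\<^sub>v w) $ i"
      using that v by (simp add: Mw)
    also have "\<dots> = (\<Sum>k<n. M $$ (i, k) * w $ k)"
      using that M w by (simp add: scalar_prod_def lessThan_atLeast0)
    finally show ?thesis .
  qed
  have cnj_mult: "complex_of_real ((cmod x)\<^sup>2) = cnj x * x" for x
    by (simp only: complex_norm_square mult.commute)
  have "z * of_real r = (\<Sum>i<m. cnj (v $ i) * (z * v $ i))"
    unfolding r_def of_real_sum cnj_mult by (simp add: sum_distrib_left mult_ac)
  also have "\<dots> = (\<Sum>i<m. \<Sum>k<n. cnj (v $ i) * M $$ (i, k) * w $ k)"
    by (intro sum.cong) (auto simp: Mw_eq sum_distrib_left mult.assoc)
  also have "\<dots> = (\<Sum>k<n. \<Sum>i<m. cnj (v $ i) * M $$ (i, k) * w $ k)"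
    by (rule sum.swap)
  also have "\<dots> = (\<Sum>k<n. cnj (w $ k) * w $ k)"
    by (intro sum.cong) (auto simp: w_eq sum_distrib_left sum_distrib_right algebra_simps)
  also have "\<dots> = of_real s"
    unfolding s_def of_real_sum cnj_mult ..
  finally have zr: "z * of_real r = of_real s" .
  obtain i where "i < m" "v $ i \<noteq> 0"
    using v by (metis carrier_vecD eq_vecI index_zero_vec)
  then have "r > 0"
    unfolding r_def by (intro sum_pos2[of _ i]) auto
  moreover have "s \<ge> 0"
    by (simp add: s_def sum_nonneg)
  moreover have "z = complex_of_real (s / r)"
    using zr \<open>r > 0\<close> by (simp add: field_simps)
  ultimately show "z = complex_of_real (Re z)" "Re z \<ge> 0"
    by simp_all
qed

lemma monic_complex_poly_eq_prod_proots:
  fixes p :: "complex poly"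
  assumes "lead_coeff p = 1"
  shows "p = (\<Prod>z\<in>#proots p. [:- z, 1:])"
proof -
  have "p \<noteq> 0"
    using assms by auto
  then obtain B where "p = smult (lead_coeff p) (\<Prod>x\<in>#B. [:- x, 1:])"
    using alg_closed_imp_factorization by blast
  then have B: "p = (\<Prod>x\<in>#B. [:- x, 1:])"
    by (metis assms smult_1_left)
  have "proots (\<Prod>x\<in>#C. [:- x, 1:]) = C" for C :: "complex multiset"
    using proots_prod_mset[of "image_mset (\<lambda>x. [:- x, 1:]) C"]
    by (auto simp: image_mset.compositionality o_def image_iff)
  with B show ?thesis
    by metis
qed

text \<open>
  The factorisation turns an enumeration of singular values, an equation between multisets, into
  a polynomial identity that can be evaluated at a point.
\<close>

lemma char_poly_gram_eq_prod:
  fixes B :: "complex mat"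
  assumes "lists_singular_values \<tau> B" and dims: "dim_row B \<le> dim_col B"
  shows "char_poly (B * mat_adjoint B) = (\<Prod>k<dim_row B. [:- complex_of_real ((\<tau> k)\<^sup>2), 1:])"
proof -
  define p where "p = char_poly (B * mat_adjoint B)"
  define f where "f = (\<lambda>x. [:- complex_of_real (x\<^sup>2), 1:])"
  have "B * mat_adjoint B \<in> carrier_mat (dim_row B) (dim_row B)"
    by (rule carrier_matI) simp_all
  from degree_monic_char_poly[OF this] have monic: "lead_coeff p = 1"
    by (simp add: p_def)
  have sv: "image_mset \<tau> (mset_set {..<dim_row B}) = image_mset (\<lambda>z. sqrt (Re z)) (proots p)"
    using assms by (simp add: lists_singular_values_def singular_values_def p_def min_def)
  have root: "f (sqrt (Re z)) = [:- z, 1:]" if "z \<in># proots p" for z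
  proof -
    have "(sqrt (Re z))\<^sup>2 = Re z"
      using proots_gram_nonneg(2)[of z B] that by (simp add: p_def)
    moreover have "complex_of_real (Re z) = z"
      using proots_gram_nonneg(1)[of z B] that by (simp add: p_def)
    ultimately show ?thesis
      by (simp only: f_def)
  qed
  have "(\<Prod>k<dim_row B. f (\<tau> k)) = prod_mset (image_mset f (image_mset \<tau> (mset_set {..<dim_row B})))"
    by (simp add: prod_unfold_prod_mset image_mset.compositionality o_def)
  also have "\<dots> = (\<Prod>z\<in>#proots p. f (sqrt (Re z)))"
    by (simp add: sv image_mset.compositionality o_def)
  also have "\<dots> = (\<Prod>z\<in>#proots p. [:- z, 1:])"
    using root by (intro arg_cong[of _ _ prod_mset] image_mset_cong) auto
  also have "\<dots> = p"
    by (rule monic_complex_poly_eq_prod_proots[OF monic, symmetric])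
  finally show ?thesis
    by (simp add: p_def f_def)
qed

text \<open>
  Not automatic from the definition, because \<open>sqrt\<close> is negative on negative numbers.
\<close>

lemma singular_values_nonneg:
  assumes "x \<in># singular_values M"
  shows "x \<ge> 0"
  using assms proots_gram_nonneg(2)[of _ M] proots_gram_nonneg(2)[of _ "mat_adjoint M"]
  by (auto simp: singular_values_def mat_adjoint_adjoint split: if_splits)

section \<open>Entries of the singular vectors\<close>

text \<open>
  In this form without division, both sides vanish when the square of \<open>\<sigma> i\<close> is repeated: a
  multiple eigenvalue of \<open>A A\<^sup>H\<close> stays an eigenvalue when a row and its column are deleted.
\<close>

lemma singular_vector_entry_rows:
  fixes A U V :: "complex mat" and \<sigma> \<tau> :: "nat \<Rightarrow> real"
  assumes U: "unitary_mat n U" and V: "unitary_mat n V"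
    and A: "A = mat_adjoint U * mat_diag n (\<lambda>i. complex_of_real (\<sigma> i)) * V"
    and \<tau>: "lists_singular_values \<tau> (delete_row j A)"
    and i: "i < n" and j: "j < n"
  shows "(\<Prod>k<n - 1. (\<sigma> i)\<^sup>2 - (\<tau> k)\<^sup>2) =
    (cmod (U $$ (i, j)))\<^sup>2 * (\<Prod>k\<in>{..<n} - {i}. (\<sigma> i)\<^sup>2 - (\<sigma> k)\<^sup>2)"
proof -
  define S where "S = mat_diag n (\<lambda>i. complex_of_real (\<sigma> i))"
  define D where "D = mat_diag n (\<lambda>i. complex_of_real ((\<sigma> i)\<^sup>2))"
  let ?U' = "mat_adjoint U" and ?V' = "mat_adjoint V"
  have U_carr: "U \<in> carrier_mat n n" "?U' \<in> carrier_mat n n"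
    and V_carr: "V \<in> carrier_mat n n" "?V' \<in> carrier_mat n n"
    using U V by (auto simp: unitary_mat_def mat_adjoint_carrier)
  have S: "S \<in> carrier_mat n n"
    by (simp add: S_def)
  have A_carr: "A \<in> carrier_mat n n"
    unfolding A S_def[symmetric] using U_carr V_carr S by simp
  note assoc = assoc_mult_mat[of _ n n _ n _ n]
  have "mat_adjoint A = ?V' * S * U"
    unfolding A S_def by (rule mat_adjoint_svd[OF U_carr(1) V_carr(1)])
  \<comment> \<open>\<open>V V\<^sup>H\<close> cancels in the middle, which leaves \<open>U\<^sup>H \<Sigma>\<^sup>2 U\<close>.\<close>
  then have "A * mat_adjoint A = ?U' * (S * ((V * ?V') * (S * U)))"
    using U_carr V_carr S by (simp add: A assoc flip: S_def)
  also have "\<dots> = ?U' * (S * (S * U))"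
    using V U_carr S by (simp add: unitary_mat_def)
  also have "\<dots> = ?U' * ((S * S) * U)"
    using U_carr S by (simp add: assoc)
  also have "S * S = D"
    by (simp add: S_def D_def power2_eq_square)
  also have "?U' * (D * U) = ?U' * D * U"
    using U_carr by (simp add: assoc D_def)
  finally have gram: "A * mat_adjoint A = ?U' * D * U" .
  define B where "B = delete_row j A"
  have dim_B: "dim_row B = n - 1" "dim_col B = n"
    using A_carr j by (simp_all add: B_def dim_delete_row)
  have "(\<Prod>k<n - 1. [:- complex_of_real ((\<tau> k)\<^sup>2), 1:]) = char_poly (B * mat_adjoint B)"
    using char_poly_gram_eq_prod[of \<tau> B] \<tau> dim_B by (simp add: B_def)
  also have "\<dots> = char_poly (mat_delete (?U' * D * U) j j)"
    using A_carr j by (simp add: B_def delete_row_gram gram)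
  also have "\<dots> = (\<Sum>k<n. smult (?U' $$ (j, k) * U $$ (k, j))
      (\<Prod>l\<in>{..<n} - {k}. [:- complex_of_real ((\<sigma> l)\<^sup>2), 1:]))"
    unfolding D_def
    by (rule char_poly_mat_delete_diagonalised) (use U U_carr j in \<open>auto simp: unitary_mat_def\<close>)
  finally have "(\<Prod>k<n - 1. complex_of_real ((\<sigma> i)\<^sup>2) - complex_of_real ((\<tau> k)\<^sup>2)) =
      (\<Sum>k<n. ?U' $$ (j, k) * U $$ (k, j) *
        (\<Prod>l\<in>{..<n} - {k}. complex_of_real ((\<sigma> i)\<^sup>2) - complex_of_real ((\<sigma> l)\<^sup>2)))"
    by (drule_tac arg_cong[of _ _ "\<lambda>p. poly p (complex_of_real ((\<sigma> i)\<^sup>2))"])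
       (simp add: poly_prod poly_sum)
  \<comment> \<open>For \<open>k \<noteq> i\<close> the product contains the factor with \<open>l = i\<close>, which is zero.\<close>
  also have "\<dots> = (\<Sum>k\<in>{i}. ?U' $$ (j, k) * U $$ (k, j) *
        (\<Prod>l\<in>{..<n} - {k}. complex_of_real ((\<sigma> i)\<^sup>2) - complex_of_real ((\<sigma> l)\<^sup>2)))"
    using i by (intro sum.mono_neutral_right) auto
  also have "\<dots> = complex_of_real ((cmod (U $$ (i, j)))\<^sup>2) *
        (\<Prod>l\<in>{..<n} - {i}. complex_of_real ((\<sigma> i)\<^sup>2) - complex_of_real ((\<sigma> l)\<^sup>2))"
    using U_carr i j by (simp add: mat_adjoint_index complex_norm_square mult.commute flip: of_real_power)
  finally have "complex_of_real (\<Prod>k<n - 1. (\<sigma> i)\<^sup>2 - (\<tau> k)\<^sup>2) =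
      complex_of_real ((cmod (U $$ (i, j)))\<^sup>2 * (\<Prod>k\<in>{..<n} - {i}. (\<sigma> i)\<^sup>2 - (\<sigma> k)\<^sup>2))"
    by simp
  then show ?thesis
    by (simp only: of_real_eq_iff)
qed

text \<open>
  When \<open>M\<close> is not square, \<open>M\<close> and \<open>M\<^sup>H\<close> have literally the same smaller Gram matrix, so the
  definition gives them the same singular values. This covers the matrices with a deleted column;
  for square \<open>M\<close> one would have to compare \<open>M M\<^sup>H\<close> with \<open>M\<^sup>H M\<close>.
\<close>

lemma lists_singular_values_mat_adjoint:
  assumes "dim_row M \<noteq> dim_col M"
  shows "lists_singular_values \<tau> (mat_adjoint M) \<longleftrightarrow> lists_singular_values \<tau> M"
  using assms
  by (auto simp: lists_singular_values_def singular_values_def mat_adjoint_adjoint min_def)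

theorem theorem1:
  fixes n :: nat and A U V :: "complex mat"
    and \<sigma> :: "nat \<Rightarrow> real" and \<sigma>row \<sigma>col :: "nat \<Rightarrow> nat \<Rightarrow> real"
  assumes "A \<in> carrier_mat n n"
    and "lists_singular_values \<sigma> A"
    and "inj_on \<sigma> {..<n}"
    and "unitary_mat n U" and "unitary_mat n V"
    and "A = mat_adjoint U * mat_diag n (\<lambda>i. complex_of_real (\<sigma> i)) * V"
    and "\<And>j. j < n \<Longrightarrow> lists_singular_values (\<sigma>row j) (delete_row j A)"
    and "\<And>s. s < n \<Longrightarrow> lists_singular_values (\<sigma>col s) (delete_col s A)"
  shows "(\<forall>i<n. \<forall>j<n. (cmod (U $$ (i, j)))\<^sup>2 =
            (\<Prod>k<n - 1. (\<sigma> i)\<^sup>2 - (\<sigma>row j k)\<^sup>2) / (\<Prod>k\<in>{..<n} - {i}. (\<sigma> i)\<^sup>2 - (\<sigma> k)\<^sup>2))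
       \<and> (\<forall>l<n. \<forall>s<n. (cmod (V $$ (l, s)))\<^sup>2 =
            (\<Prod>t<n - 1. (\<sigma> l)\<^sup>2 - (\<sigma>col s t)\<^sup>2) / (\<Prod>t\<in>{..<n} - {l}. (\<sigma> l)\<^sup>2 - (\<sigma> t)\<^sup>2))"
proof -
  have nonneg: "\<sigma> k \<ge> 0" if "k < n" for k
  proof (rule singular_values_nonneg)
    have "\<sigma> k \<in># image_mset \<sigma> (mset_set {..<n})"
      using that by simp
    then show "\<sigma> k \<in># singular_values A"
      using assms(1,2) by (simp only: lists_singular_values_def carrier_matD min.idem)
  qed
  have denom: "(\<Prod>k\<in>{..<n} - {i}. (\<sigma> i)\<^sup>2 - (\<sigma> k)\<^sup>2) \<noteq> 0" if "i < n" for i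
    using that nonneg inj_onD[OF assms(3)] by (auto simp: power2_eq_iff_nonneg)
  have adj: "mat_adjoint A = mat_adjoint V * mat_diag n (\<lambda>i. complex_of_real (\<sigma> i)) * U"
    using assms(4,5) unfolding assms(6) unitary_mat_def by (blast intro: mat_adjoint_svd)
  have col: "lists_singular_values (\<sigma>col s) (delete_row s (mat_adjoint A))" if "s < n" for s
    using assms(1) assms(8)[OF that] that
    by (simp add: delete_row_mat_adjoint lists_singular_values_mat_adjoint dim_delete_col)
  show ?thesis
    using singular_vector_entry_rows[OF assms(4,5,6) assms(7)]
      singular_vector_entry_rows[OF assms(5,4) adj col] denom
    by auto
qed

end
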